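(* Let $\mathcal{U}$ be a finite set of users, $\mathcal{V}$ a finite vocabulary, and $\mathcal{D}$ a private database of user counts $(\Delta\mathbf{c}^n)_{n\in\mathcal{U}}$ over $\mathcal{V}$. Let $\boldsymbol{\alpha}$ be a vector of public counts over $\mathcal{V}$, and let $\hat{\mathbf{x}}$, $\hat{\mathbf{x}}_{-n}$ $(n\in\mathcal{U})$ and $\boldsymbol{\mu}_p$ be the vectors in $\mathbb{R}^{|\mathcal{V}|}$ defined in the context. Let $\rho\in(0,1)$, $\sigma_{ps}>0$, $\epsilon\in(0,1)$ and $\delta\in(0,1)$. Let $\mathcal{M}$ be the Gaussian mechanism that outputs a sample $\mathbf{h}\sim\mathcal{N}(\rho\hat{\mathbf{x}}+(1-\rho)\boldsymbol{\mu}_p,\ \sigma_{ps}\mathbf{I})$, where $\sigma_{ps}$ is the per-coordinate standard deviation. If $$\|\hat{\mathbf{x}}-\hat{\mathbf{x}}_{-n}\|_2\ \le\ \frac{\epsilon\,\sigma_{ps}}{\rho\sqrt{2\log(1.25/\delta)}}\qquad\text{for all } n\in\mathcal{U},$$ then $\mathcal{M}$ is $(\epsilon,\delta)$-differentially private.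
   Context: Each user $n\in\mathcal{U}$ has a vector of nonnegative counts $\Delta\mathbf{c}^n\in\mathbb{R}^{|\mathcal{V}|}$. Here $\Delta c^n_i\ge 0$ is the count of word $i\in\mathcal{V}$ for user $n$. The total counts are $\mathbf{c}=\sum_{n\in\mathcal{U}}\Delta\mathbf{c}^n$. $\mathcal{D}_{-n}$ denotes the database $\mathcal{D}$ with user $n$ removed, so its total counts are $\mathbf{c}-\Delta\mathbf{c}^n$. $\mathcal{D}$ and $\mathcal{D}_{-n}$ are called adjacent. The public counts $\boldsymbol{\alpha}$ are nonnegative, fixed, and independent of the private database. Definitions, for $i\in\mathcal{V}$: $$\mu_{pi}=\log(\alpha_i+1)-\tfrac{1}{|\mathcal{V}|}\sum_{j\in\mathcal{V}}\log(\alpha_j+1),$$ $$\hat{x}_i=\log(c_i+1)-\tfrac{1}{|\mathcal{V}|}\sum_{j\in\mathcal{V}}\log(c_j+1),$$ $$(\hat{x}_{-n})_i=\log(c_i-\Delta c^n_i+1)-\tfrac{1}{|\mathcal{V}|}\sum_{j\in\mathcal{V}}\log(c_j-\Delta c^n_j+1).$$ $\mathcal{N}(\mathbf{m},\sigma\mathbf{I})$ denotes the law of a Gaussian vector with independent coordinates, mean $\mathbf{m}$ and standard deviation $\sigma$ in each coordinate. The mechanism applied to $\mathcal{D}$ uses $\hat{\mathbf{x}}$. Applied to $\mathcal{D}_{-n}$, it uses $\hat{\mathbf{x}}_{-n}$ in place of $\hat{\mathbf{x}}$, with the same fixed $\rho,\sigma_{ps},\boldsymbol{\mu}_p$. A randomized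 mechanism $\mathcal{M}$ is $(\epsilon,\delta)$-differentially private if for adjacent datasets $\mathcal{D}$ and $\mathcal{D}_{-n}$, for every $n\in\mathcal{U}$, and all measurable sets $\mathcal{S}\subseteq \mathrm{Range}(\mathcal{M})$: $\Pr[\mathcal{M}(\mathcal{D})\in\mathcal{S}]\le e^{\epsilon}\Pr[\mathcal{M}(\mathcal{D}_{-n})\in\mathcal{S}]+\delta$. *)

theory Defs
  imports "HOL-Probability.Probability"
begin

text \<open>A database assigns to each of its users (the domain of the map) a vector of word counts;
  the vocabulary is the finite index type.\<close>

type_synonym ('u, 'v) database = "'u \<rightharpoonup> real ^ 'v"

definition total_counts :: "('u, 'v::finite) database \<Rightarrow> real ^ 'v" where
  "total_counts D = (\<Sum>n\<in>dom D. the (D n))"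

definition remove_user :: "'u \<Rightarrow> ('u, 'v) database \<Rightarrow> ('u, 'v) database" where
  "remove_user n D = D(n := None)"

definition centered_log :: "real ^ 'v \<Rightarrow> real ^ 'v::finite" where
  "centered_log c = (\<chi> i. ln (c $ i + 1) - 1 / real CARD('v) * (\<Sum>j\<in>UNIV. ln (c $ j + 1)))"

definition x_hat :: "('u, 'v::finite) database \<Rightarrow> real ^ 'v" where
  "x_hat D = centered_log (total_counts D)"

definition x_hat_minus :: "('u, 'v::finite) database \<Rightarrow> 'u \<Rightarrow> real ^ 'v" where
  "x_hat_minus D n = centered_log (total_counts D - the (D n))"

lemma x_hat_remove_user:
  assumes "finite (dom D)" "n \<in> dom D"
  shows "x_hat (remove_user n D) = x_hat_minus D n"
proof -
  have "total_counts (remove_user n D) = (\<Sum>k\<in>dom D - {n}. the (D k))"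
    unfolding total_counts_def remove_user_def by (rule sum.cong) auto
  also have "\<dots> = total_counts D - the (D n)"
    using assms by (simp add: total_counts_def sum_diff1)
  finally show ?thesis
    by (simp add: x_hat_def x_hat_minus_def)
qed

text \<open>The parameter \<open>\<sigma>\<close> is the standard deviation of each coordinate, not the variance.\<close>

definition gaussian_vector :: "real ^ 'v \<Rightarrow> real \<Rightarrow> (real ^ 'v::finite) measure" where
  "gaussian_vector m \<sigma> =
     distr (\<Pi>\<^sub>M i\<in>UNIV. density lborel (normal_density (m $ i) \<sigma>)) borel (\<lambda>f. \<chi> i. f i)"

lemma sets_gaussian_vector [simp]: "sets (gaussian_vector m \<sigma>) = sets borel"
  by (simp add: gaussian_vector_def)

lemma measurable_vec_lambda_PiM:
  "(\<lambda>f. \<chi> i. f i) \<in> (\<Pi>\<^sub>M i\<in>(UNIV :: 'v::finite set). density lborel (normal_density (m $ i) \<sigma>))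
     \<rightarrow>\<^sub>M (borel :: (real ^ 'v) measure)"
  (is "?h \<in> measurable ?P _")
proof (rule borel_measurable_euclidean_space[THEN iffD2], rule ballI)
  fix b :: "real ^ 'v" assume "b \<in> Basis"
  then obtain i where b: "b = axis i 1" by (auto simp: Basis_vec_def)
  have "(\<lambda>f. f i) \<in> borel_measurable ?P"
    using measurable_component_singleton[of i UNIV "\<lambda>i. density lborel (normal_density (m $ i) \<sigma>)"]
    by simp
  then show "(\<lambda>f. ?h f \<bullet> b) \<in> borel_measurable ?P"
    by (simp add: b inner_axis)
qed

lemma prob_space_gaussian_vector:
  assumes "0 < \<sigma>"
  shows "prob_space (gaussian_vector m \<sigma>)"
  unfolding gaussian_vector_def
  by (intro prob_space.prob_space_distr prob_space_PiM prob_space_normal_density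
        measurable_vec_lambda_PiM assms)

definition gaussian_mechanism ::
  "real \<Rightarrow> real \<Rightarrow> real ^ 'v \<Rightarrow> ('u, 'v::finite) database \<Rightarrow> (real ^ 'v) measure" where
  "gaussian_mechanism \<rho> \<sigma> \<mu> D = gaussian_vector (\<rho> *\<^sub>R x_hat D + (1 - \<rho>) *\<^sub>R \<mu>) \<sigma>"

text \<open>Differential privacy at the given database \<open>D\<close>: its adjacent databases are those obtained by
  removing one user. A randomized mechanism maps a database to the law of its output.\<close>

definition differentially_private ::
  "(('u, 'v::finite) database \<Rightarrow> 'a measure) \<Rightarrow> ('u, 'v) database \<Rightarrow> real \<Rightarrow> real \<Rightarrow> bool" where
  "differentially_private M D \<epsilon> \<delta> \<longleftrightarrow>
     (\<forall>n\<in>dom D. \<forall>S\<in>sets (M D).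
        measure (M D) S \<le> exp \<epsilon> * measure (M (remove_user n D)) S + \<delta>)"

end

theory Submission imports Defs
begin

text \<open>The law of the output on \<open>D\<close> has density \<open>exp L\<close> with respect to its law on an adjacent
  database, where the privacy loss \<open>L\<close> is an affine function of the output. Outside the event
  \<open>\<epsilon> < L\<close> the densities differ by a factor of at most \<open>exp \<epsilon>\<close>, so this event only has
  to have probability at most \<open>\<delta>\<close>. Projecting onto the difference of the means
  reduces this to a tail bound for a standard normal variable at a threshold of at least
  \<open>c - 1 / (2 * c)\<close>, where \<open>c\<^sup>2 = 2 * ln (1.25 / \<delta>)\<close>.\<close>

section \<open>Tails of the standard normal distribution\<close>

text \<open>The reflection x to -x preserves the density, so two disjoint half-lines carry equal
  mass and share a total of at most 1.\<close>

lemma std_normal_tail_0: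
  "measure (density lborel std_normal_density) {0<..} \<le> 1 / 2"
proof -
  let ?N = "density lborel std_normal_density"
  interpret N: prob_space ?N by (rule prob_space_normal_density) simp
  have "emeasure ?N {0<..} = (\<integral>\<^sup>+x. ennreal (std_normal_density x) * indicator {0<..} x \<partial>lborel)"
    by (simp add: emeasure_density)
  also have "\<dots> = (\<integral>\<^sup>+x. ennreal (std_normal_density x) * indicator {..<0} x \<partial>lborel)"
    by (subst nn_integral_real_affine[where c = "-1" and t = 0])
       (auto simp: std_normal_density_def intro!: nn_integral_cong split: split_indicator)
  also have "\<dots> = emeasure ?N {..<0}"
    by (simp add: emeasure_density)
  finally have "N.prob {0<..} = N.prob {..<0}"
    by (simp add: measure_def)
  moreover have "N.prob ({0<..} \<union> {..<0}) = N.prob {0<..} + N.prob {..<0}"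
    by (rule N.finite_measure_Union) auto
  ultimately show ?thesis
    using N.prob_le_1[of "{0<..} \<union> {..<0}"] by simp
qed

text \<open>After translating by \<open>t\<close>, the exponent of the density at
  \<open>t + x\<close> contains the cross term -t * x, which is at most 0 on the half-line x > 0.
  Dropping it leaves exp(-t^2 / 2) times the mass of the positive half-line. The factor 1/2 matters:
  it later absorbs a factor exp(1/2).\<close>

lemma std_normal_tail_nonneg:
  assumes "0 \<le> t"
  shows "measure (density lborel std_normal_density) {t<..} \<le> exp (- t\<^sup>2 / 2) / 2"
proof -
  let ?N = "density lborel std_normal_density"
  interpret N: prob_space ?N by (rule prob_space_normal_density) simp
  have le: "std_normal_density (t + x) \<le> exp (- t\<^sup>2 / 2) * std_normal_density x" if "0 < x" for x
  proof -
    have "0 \<le> t * x" using assms that by simp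
    then have "- (t + x)\<^sup>2 / 2 \<le> - t\<^sup>2 / 2 + - x\<^sup>2 / 2"
      by (simp add: power2_eq_square field_simps)
    then have "exp (- (t + x)\<^sup>2 / 2) \<le> exp (- t\<^sup>2 / 2) * exp (- x\<^sup>2 / 2)"
      by (simp only: exp_add[symmetric] exp_le_cancel_iff)
    then show ?thesis
      by (simp add: std_normal_density_def field_simps)
  qed
  have "emeasure ?N {t<..} = (\<integral>\<^sup>+x. ennreal (std_normal_density x) * indicator {t<..} x \<partial>lborel)"
    by (simp add: emeasure_density)
  also have "\<dots> = (\<integral>\<^sup>+x. ennreal (std_normal_density (t + x)) * indicator {0<..} x \<partial>lborel)"
    by (subst nn_integral_real_affine[where c = 1 and t = t])
       (auto intro!: nn_integral_cong split: split_indicator)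
  also have "\<dots> \<le> (\<integral>\<^sup>+x. ennreal (exp (- t\<^sup>2 / 2)) *
      (ennreal (std_normal_density x) * indicator {0<..} x) \<partial>lborel)"
    using le by (intro nn_integral_mono) (auto simp: ennreal_mult[symmetric] split: split_indicator)
  also have "\<dots> = ennreal (exp (- t\<^sup>2 / 2)) * emeasure ?N {0<..}"
    by (simp add: nn_integral_cmult emeasure_density)
  finally have "N.prob {t<..} \<le> exp (- t\<^sup>2 / 2) * N.prob {0<..}"
    by (simp add: N.emeasure_eq_measure ennreal_mult[symmetric])
  also have "\<dots> \<le> exp (- t\<^sup>2 / 2) * (1 / 2)"
    by (intro mult_left_mono std_normal_tail_0) simp
  finally show ?thesis by simp
qed

text \<open>The density is at most 1/2 because sqrt(2 pi) is at least 2, so the interval from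
  \<open>t\<close> to 0 adds at most half its length to the mass beyond 0.\<close>

lemma std_normal_tail_neg:
  assumes "t \<le> 0"
  shows "measure (density lborel std_normal_density) {t<..} \<le> 1 / 2 - t / 2"
proof -
  let ?N = "density lborel std_normal_density"
  interpret N: prob_space ?N by (rule prob_space_normal_density) simp
  have "2 \<le> sqrt (2 * pi)"
    using pi_gt3 by (intro real_le_rsqrt) simp
  then have le: "std_normal_density x \<le> 1 / 2" for x
    unfolding std_normal_density_def
    using mult_mono[of "1 / sqrt (2 * pi)" "1 / 2" "exp (- x\<^sup>2 / 2)" 1] by (simp add: frac_le)
  have "emeasure ?N {t<..0} = (\<integral>\<^sup>+x. ennreal (std_normal_density x) * indicator {t<..0} x \<partial>lborel)"
    by (simp add: emeasure_density)
  also have "\<dots> \<le> (\<integral>\<^sup>+x. ennreal (1 / 2) * indicator {t<..0} x \<partial>lborel)"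
    using le by (intro nn_integral_mono mult_right_mono ennreal_leI) auto
  also have "\<dots> = ennreal (1 / 2 * (0 - t))"
    using assms by (simp add: nn_integral_cmult ennreal_mult[symmetric] del: ennreal_half)
  finally have "N.prob {t<..0} \<le> - t / 2"
    using assms by (simp add: N.emeasure_eq_measure)
  moreover have "N.prob ({t<..0} \<union> {0<..}) \<le> N.prob {t<..0} + N.prob {0<..}"
    by (rule measure_Un_le) auto
  moreover have "{t<..0} \<union> {0<..} = {t<..}"
    using assms by auto
  ultimately show ?thesis
    using std_normal_tail_0 by simp
qed

text \<open>The proof splits on the sign of the threshold \<open>t\<close>. If it is nonnegative,
  the exponential tail bound applies. If it is negative, \<open>c\<close> is so small that
  \<open>\<delta>\<close> exceeds 0.9, and the linear bound is enough.\<close>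

lemma std_normal_tail_le_delta:
  fixes \<delta> :: real
  assumes "0 < \<delta>" "\<delta> < 1"
  defines "c \<equiv> sqrt (2 * ln (1.25 / \<delta>))"
  shows "measure (density lborel std_normal_density) {c - 1 / (2 * c)<..} \<le> \<delta>"
proof -
  \<comment> \<open>The bound ln y <= y - 1 at y = 4/5 * \<open>\<delta>\<close> < 4/5 keeps the
    logarithm at least 0.2. Hence c^2 >= 0.4 > 0.36, which gives c >= 0.6 below.\<close>
  have "ln (1.25 / \<delta>) = ln (inverse (4 / 5 * \<delta>))"
    by (simp add: field_simps)
  also have "\<dots> = - ln (4 / 5 * \<delta>)"
    by (rule ln_inverse)
  finally have ln_ge: "0.2 \<le> ln (1.25 / \<delta>)"
    using ln_le_minus_one[of "4 / 5 * \<delta>"] assms by simp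
  then have c2: "c\<^sup>2 = 2 * ln (1.25 / \<delta>)"
    unfolding c_def by (intro real_sqrt_pow2) simp
  then have \<delta>: "\<delta> = 1.25 * exp (- c\<^sup>2 / 2)"
    using assms by (simp add: exp_minus)
  have c6: "0.6 \<le> c"
    unfolding c_def using ln_ge by (intro real_le_rsqrt) (simp add: power2_eq_square)
  define t where "t = c - 1 / (2 * c)"
  have t2: "t\<^sup>2 = c\<^sup>2 - 1 + 1 / (4 * c\<^sup>2)"
    using c6 unfolding t_def by (simp add: power2_eq_square field_simps)
  show ?thesis
  proof (cases "0 \<le> t")
    case True
    \<comment> \<open>The cross term in t^2 is exactly -1, so replacing \<open>t\<close> by
      \<open>c\<close> costs a factor exp(1/2). As this is at most 2, the 1/2 of the tail bound
      compensates for it.\<close>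
    have "exp (1 / 2 :: real) \<le> 2"
      using exp_bound[of "1/2"] by (simp add: power2_eq_square)
    have "- t\<^sup>2 / 2 \<le> 1 / 2 + - c\<^sup>2 / 2"
      unfolding t2 by (simp add: field_simps)
    then have "exp (- t\<^sup>2 / 2) \<le> exp (1 / 2) * exp (- c\<^sup>2 / 2)"
      by (simp only: exp_add[symmetric] exp_le_cancel_iff)
    also have "\<dots> \<le> 2 * exp (- c\<^sup>2 / 2)"
      using \<open>exp (1 / 2) \<le> 2\<close> by (intro mult_right_mono) auto
    finally have "measure (density lborel std_normal_density) {t<..} \<le> exp (- c\<^sup>2 / 2)"
      using std_normal_tail_nonneg[OF True] by linarith
    also have "\<dots> \<le> \<delta>"
      unfolding \<delta> by simp
    finally show ?thesis
      unfolding t_def .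
  next
    case False
    \<comment> \<open>Here c^2 < 1/2, so \<open>\<delta>\<close> >= 1.25 * 3/4 = 0.9375, while t >=
      -0.3 bounds the tail by 1/2 + 0.15 = 0.65.\<close>
    then have "c * (c - 1 / (2 * c)) < 0"
      using c6 unfolding t_def by (intro mult_pos_neg) auto
    then have "c\<^sup>2 < 1 / 2"
      using c6 by (simp add: power2_eq_square algebra_simps)
    then have "3 / 4 \<le> exp (- c\<^sup>2 / 2)"
      using exp_ge_add_one_self[of "- c\<^sup>2 / 2"] by linarith
    moreover have "1 / (2 * c) \<le> 1 / (2 * 0.6)"
      using c6 by (intro frac_le) auto
    then have "- 0.3 \<le> t"
      using c6 unfolding t_def by simp
    ultimately show ?thesis
      using std_normal_tail_neg[of t] False \<delta> unfolding t_def[symmetric] by simp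
  qed
qed

section \<open>Gaussian vectors\<close>

text \<open>It suffices to compare both measures on boxes. The indicator of a box is the product of
  the indicators of its sides, so the integral over the box factors into one-dimensional
  integrals.\<close>

lemma PiM_density:
  assumes "finite I" "product_sigma_finite M" "product_sigma_finite (\<lambda>i. density (M i) (f i))"
    and f [measurable]: "\<And>i. i \<in> I \<Longrightarrow> f i \<in> borel_measurable (M i)"
  shows "PiM I (\<lambda>i. density (M i) (f i)) = density (PiM I M) (\<lambda>x. \<Prod>i\<in>I. f i (x i))"
proof -
  interpret M: product_sigma_finite M by fact
  interpret N: product_sigma_finite "\<lambda>i. density (M i) (f i)" by fact
  have sets: "sets (PiM I (\<lambda>i. density (M i) (f i))) = sets (PiM I M)"
    by (intro sets_PiM_cong) auto
  show ?thesis
  proof (rule N.PiM_eqI[symmetric])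
    fix A assume "\<And>i. i \<in> I \<Longrightarrow> A i \<in> sets (density (M i) (f i))"
    then have A [measurable]: "\<And>i. i \<in> I \<Longrightarrow> A i \<in> sets (M i)" by simp
    have "emeasure (density (PiM I M) (\<lambda>x. \<Prod>i\<in>I. f i (x i))) (Pi\<^sub>E I A) =
        (\<integral>\<^sup>+x. (\<Prod>i\<in>I. f i (x i)) * indicator (Pi\<^sub>E I A) x \<partial>PiM I M)"
      using assms(1) A by (intro emeasure_density borel_measurable_prod_ennreal sets_PiM_I_finite) auto
    also have "\<dots> = (\<integral>\<^sup>+x. (\<Prod>i\<in>I. f i (x i) * indicator (A i) (x i)) \<partial>PiM I M)"
    proof (rule nn_integral_cong)
      fix x assume x: "x \<in> space (PiM I M)"
      have "indicator (Pi\<^sub>E I A) x = (\<Prod>i\<in>I. indicator (A i) (x i) :: ennreal)"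
      proof (cases "x \<in> Pi\<^sub>E I A")
        case False
        \<comment> \<open>Points of the product space are extensional, so one outside the box must
          violate a side condition at some index in \<open>I\<close>.\<close>
        then obtain i where "i \<in> I" "x i \<notin> A i"
          using x by (auto simp: space_PiM PiE_iff)
        then have "\<exists>i\<in>I. indicator (A i) (x i) = (0 :: ennreal)"
          by (auto intro!: bexI[of _ i])
        then have "(\<Prod>i\<in>I. indicator (A i) (x i) :: ennreal) = 0"
          by (rule prod_zero[OF assms(1)])
        then show ?thesis
          using False by simp
      qed (auto simp: PiE_iff)
      then show "(\<Prod>i\<in>I. f i (x i)) * indicator (Pi\<^sub>E I A) x =
          (\<Prod>i\<in>I. f i (x i) * indicator (A i) (x i))"
        by (simp add: prod.distrib)
    qed
    also have "\<dots> = (\<Prod>i\<in>I. \<integral>\<^sup>+x. f i x * indicator (A i) x \<partial>M i)"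
      using assms(1) by (intro M.product_nn_integral_prod) auto
    also have "\<dots> = (\<Prod>i\<in>I. emeasure (density (M i) (f i)) (A i))"
      by (intro prod.cong) (auto simp: emeasure_density)
    finally show "emeasure (density (PiM I M) (\<lambda>x. \<Prod>i\<in>I. f i (x i))) (Pi\<^sub>E I A) =
        (\<Prod>i\<in>I. emeasure (density (M i) (f i)) (A i))" .
  qed (use assms(1) sets in auto)
qed

text \<open>The two normal densities have the same standard deviation, so their normalising
  constants cancel and only the quotient of the exponentials remains.\<close>

lemma density_normal_shift:
  assumes "0 < \<sigma>"
  shows "density (density lborel (normal_density b \<sigma>))
      (\<lambda>x. ennreal (exp (((x - b)\<^sup>2 - (x - a)\<^sup>2) / (2 * \<sigma>\<^sup>2)))) = density lborel (normal_density a \<sigma>)"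
proof -
  have "normal_density b \<sigma> x * exp (((x - b)\<^sup>2 - (x - a)\<^sup>2) / (2 * \<sigma>\<^sup>2)) = normal_density a \<sigma> x" for x
    unfolding normal_density_def mult.assoc exp_add[symmetric]
    by (simp add: diff_divide_distrib)
  then show ?thesis
    by (simp add: density_density_eq ennreal_mult[symmetric])
qed

text \<open>The coordinatewise density ratios multiply, and their exponents add up to a difference
  of squared Euclidean norms. The resulting exponent is the privacy loss.\<close>

lemma gaussian_vector_shift:
  assumes "0 < \<sigma>"
  shows "gaussian_vector m \<sigma> = density (gaussian_vector m' \<sigma>)
    (\<lambda>x. ennreal (exp (((norm (x - m'))\<^sup>2 - (norm (x - m))\<^sup>2) / (2 * \<sigma>\<^sup>2))))"
proof -
  let ?N = "\<lambda>m i. density lborel (normal_density (m $ i) \<sigma>)"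
  define r where "r i x = ennreal (exp (((x - m' $ i)\<^sup>2 - (x - m $ i)\<^sup>2) / (2 * \<sigma>\<^sup>2)))" for i x
  define g where "g x = ennreal (exp (((norm (x - m'))\<^sup>2 - (norm (x - m))\<^sup>2) / (2 * \<sigma>\<^sup>2)))" for x
  have [measurable]: "r i \<in> borel_measurable borel" for i
    unfolding r_def by measurable
  have [measurable]: "g \<in> borel_measurable borel"
    unfolding g_def by measurable
  have N: "density (?N m' i) (r i) = ?N m i" for i
    unfolding r_def by (rule density_normal_shift[OF assms])
  have sf: "product_sigma_finite (?N m)" for m
    by (intro product_sigma_finite.intro prob_space_imp_sigma_finite prob_space_normal_density assms)
  have prod: "(\<Prod>i\<in>UNIV. r i (x i)) = g (\<chi> i. x i)" for x
  proof -
    have "(\<Prod>i\<in>UNIV. r i (x i)) =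
        ennreal (exp (\<Sum>i\<in>UNIV. ((x i - m' $ i)\<^sup>2 - (x i - m $ i)\<^sup>2) / (2 * \<sigma>\<^sup>2)))"
      by (simp add: r_def prod_ennreal exp_sum)
    also have "\<dots> = g (\<chi> i. x i)"
      by (simp add: g_def power2_norm_eq_inner inner_vec_def sum_subtractf
          sum_divide_distrib[symmetric] flip: power2_eq_square)
    finally show ?thesis .
  qed
  have "PiM UNIV (?N m) = PiM UNIV (\<lambda>i. density (?N m' i) (r i))"
    by (simp add: N)
  also have "\<dots> = density (PiM UNIV (?N m')) (\<lambda>x. \<Prod>i\<in>UNIV. r i (x i))"
    by (rule PiM_density) (simp_all add: N sf)
  also have "\<dots> = density (PiM UNIV (?N m')) (\<lambda>x. g (\<chi> i. x i))"
    by (simp add: prod)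
  finally have "gaussian_vector m \<sigma> =
      distr (density (PiM UNIV (?N m')) (\<lambda>x. g (\<chi> i. x i))) borel (\<lambda>f. \<chi> i. f i)"
    by (simp add: gaussian_vector_def)
  also have "\<dots> = density (gaussian_vector m' \<sigma>) g"
    unfolding gaussian_vector_def
    by (rule density_distr[symmetric]) (auto intro: measurable_vec_lambda_PiM)
  finally show ?thesis
    by (simp add: g_def[abs_def])
qed

text \<open>The inner product with \<open>v\<close> is a sum of independent centred normal
  variables, whose variances add up to the square of \<open>\<sigma> * norm v\<close>.\<close>

lemma gaussian_vector_inner:
  assumes "0 < \<sigma>" "v \<noteq> 0"
  shows "distributed (gaussian_vector m \<sigma>) lborel (\<lambda>x. (x - m) \<bullet> v / (\<sigma> * norm v)) std_normal_density"
proof -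
  let ?N = "\<lambda>i. density lborel (normal_density (m $ i) \<sigma>)"
  let ?P = "PiM UNIV ?N"
  let ?h = "\<lambda>f. \<chi> i. f i"
  let ?X = "\<lambda>i x. - (v $ i) * m $ i + v $ i * x i"
  \<comment> \<open>A coordinate with \<open>v $ i = 0\<close> contributes a constant, which has no
    normal density, so the sum runs over the other coordinates only. There is at least one, since
    \<open>v\<close> is nonzero.\<close>
  define I where "I = {i. v $ i \<noteq> 0}"
  have N: "prob_space (?N i)" for i
    by (rule prob_space_normal_density[OF assms(1)])
  interpret P: prob_space ?P
    by (intro prob_space_PiM N)
  have comp [measurable]: "(\<lambda>x. x i) \<in> borel_measurable ?P" for i
    using measurable_component_singleton[of i UNIV ?N] by simp
  have distr: "distr ?P borel (\<lambda>x. x i) = ?N i" for i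
  proof -
    have "distr ?P borel (\<lambda>x. x i) = distr ?P (?N i) (\<lambda>x. x i)"
      by (intro distr_cong) auto
    also have "\<dots> = ?N i"
      by (rule distr_PiM_component) (auto intro: N)
    finally show ?thesis .
  qed
  \<comment> \<open>Independence means that the joint law is the product of the marginals. The joint
    map of all coordinates is the identity, so its law is the product measure itself.\<close>
  have "P.indep_vars (\<lambda>_. borel) (\<lambda>i x. x i) UNIV"
  proof (subst P.indep_vars_iff_distr_eq_PiM')
    have "distr ?P (PiM UNIV (\<lambda>_. borel)) (\<lambda>x. \<lambda>i\<in>UNIV. x i) = distr ?P ?P (\<lambda>x. x)"
      by (intro distr_cong sets_PiM_cong) auto
    then show "distr ?P (PiM UNIV (\<lambda>_. borel)) (\<lambda>x. \<lambda>i\<in>UNIV. x i) =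
        PiM UNIV (\<lambda>i. distr ?P borel (\<lambda>x. x i))"
      by (simp add: distr)
  qed auto
  then have "P.indep_vars (\<lambda>_. borel) ?X UNIV"
    by (rule P.indep_vars_compose2) auto
  then have indep: "P.indep_vars (\<lambda>_. borel) ?X I"
    by (rule P.indep_vars_subset) simp
  have proj: "distributed ?P lborel (\<lambda>x. x i) (normal_density (m $ i) \<sigma>)" for i
    unfolding distributed_def distr[of i, symmetric]
    by (intro conjI distr_cong) (simp_all add: borel_measurable_normal_density)
  have X: "distributed ?P lborel (?X i) (normal_density 0 (\<bar>v $ i\<bar> * \<sigma>))" if "i \<in> I" for i
    using P.normal_density_affine[OF proj[of i] assms(1), of "v $ i" "- (v $ i) * m $ i"] that
    by (simp add: I_def)
  have I: "I \<noteq> {}"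
    using assms(2) by (auto simp: I_def vec_eq_iff)
  have "sqrt (\<Sum>i\<in>I. (\<bar>v $ i\<bar> * \<sigma>)\<^sup>2) = \<sigma> * norm v"
  proof -
    have "(\<Sum>i\<in>I. (\<bar>v $ i\<bar> * \<sigma>)\<^sup>2) = (\<Sum>i\<in>UNIV. (\<bar>v $ i\<bar> * \<sigma>)\<^sup>2)"
      by (rule sum.mono_neutral_left) (auto simp: I_def)
    also have "\<dots> = (\<sigma> * norm v)\<^sup>2"
      by (simp add: power_mult_distrib power2_norm_eq_inner inner_vec_def sum_distrib_left
          mult.commute flip: power2_eq_square)
    finally show ?thesis
      using assms(1) by simp
  qed
  moreover have "distributed ?P lborel (\<lambda>x. \<Sum>i\<in>I. ?X i x)
      (normal_density (\<Sum>i\<in>I. 0) (sqrt (\<Sum>i\<in>I. (\<bar>v $ i\<bar> * \<sigma>)\<^sup>2)))"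
    using assms(1) I by (intro P.sum_indep_normal indep X) (auto simp: I_def)
  moreover have "(\<Sum>i\<in>I. ?X i x) = (?h x - m) \<bullet> v" for x
  proof -
    have "(\<Sum>i\<in>I. ?X i x) = (\<Sum>i\<in>UNIV. ?X i x)"
      by (rule sum.mono_neutral_left) (auto simp: I_def)
    then show ?thesis
      by (simp add: inner_vec_def algebra_simps)
  qed
  ultimately have "distributed ?P lborel (\<lambda>x. (?h x - m) \<bullet> v) (normal_density 0 (\<sigma> * norm v))"
    by simp
  then have "distributed ?P lborel (\<lambda>x. (?h x - m) \<bullet> v / (\<sigma> * norm v)) std_normal_density"
    using assms P.normal_standard_normal_convert[of "\<sigma> * norm v" "\<lambda>x. (?h x - m) \<bullet> v" 0] by simp
  then show ?thesis
    using measurable_vec_lambda_PiM[of m \<sigma>]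
    by (simp add: distributed_def gaussian_vector_def distr_distr comp_def)
qed

section \<open>Privacy loss and differential privacy\<close>

lemma gaussian_vector_privacy_loss_tail:
  fixes m m' :: "real ^ 'v::finite"
  assumes "0 < \<sigma>" "0 < \<epsilon>" "\<epsilon> < 1" "0 < \<delta>" "\<delta> < 1"
    and le: "norm (m - m') \<le> \<epsilon> * \<sigma> / sqrt (2 * ln (1.25 / \<delta>))"
  shows "measure (gaussian_vector m \<sigma>)
    {x. \<epsilon> < ((norm (x - m'))\<^sup>2 - (norm (x - m))\<^sup>2) / (2 * \<sigma>\<^sup>2)} \<le> \<delta>"
proof (cases "m = m'")
  \<comment> \<open>For equal means the loss is identically 0 and never exceeds
    \<open>\<epsilon>\<close>; that case is left to the end. Distinct means allow normalising by
    \<open>norm v\<close>.\<close>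
  case False
  let ?G = "gaussian_vector m \<sigma>" and ?N = "density lborel std_normal_density"
  define v where "v = m - m'"
  define c where "c = sqrt (2 * ln (1.25 / \<delta>))"
  define Y where "Y x = (x - m) \<bullet> v / (\<sigma> * norm v)" for x
  define s where "s = norm v / \<sigma>"
  have v: "v \<noteq> 0" using False by (simp add: v_def)
  interpret N: prob_space ?N by (rule prob_space_normal_density) simp
  have Y: "distributed ?G lborel Y std_normal_density"
    unfolding Y_def by (rule gaussian_vector_inner[OF assms(1) v])
  have "0 < c"
    using assms unfolding c_def by simp
  have "0 < s"
    using v assms(1) by (simp add: s_def)
  have sc: "s * c \<le> \<epsilon>"
    using le assms(1) \<open>0 < c\<close> unfolding v_def[symmetric] c_def[symmetric] s_def
    by (simp add: field_simps)
  \<comment> \<open>The loss equals s * (Y + s/2), so it exceeds \<open>\<epsilon>\<close> exactly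
    when \<open>Y\<close> exceeds the right-hand side. From s * c <= \<open>\<epsilon>\<close> the
    first term is at least \<open>c\<close>; with \<open>\<epsilon>\<close> < 1 also s <= 1/c, which
    bounds the subtracted term by 1/(2c).\<close>
  have "c - 1 / (2 * c) \<le> \<epsilon> / s - s / 2"
  proof -
    have "c \<le> \<epsilon> / s"
      using sc \<open>0 < s\<close> by (simp add: field_simps)
    moreover have "s \<le> 1 / c"
      using sc \<open>0 < c\<close> assms(3) by (simp add: field_simps)
    ultimately show ?thesis by simp
  qed
  moreover have "{x. \<epsilon> < ((norm (x - m'))\<^sup>2 - (norm (x - m))\<^sup>2) / (2 * \<sigma>\<^sup>2)} = Y -` {\<epsilon> / s - s / 2<..}"
  proof -
    have "((norm (x - m'))\<^sup>2 - (norm (x - m))\<^sup>2) / (2 * \<sigma>\<^sup>2) = s * (Y x + s / 2)" for x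
    proof -
      have "(norm ((x - m) + v))\<^sup>2 = (norm (x - m))\<^sup>2 + 2 * ((x - m) \<bullet> v) + (norm v)\<^sup>2"
        unfolding power2_norm_eq_inner inner_add_left inner_add_right
        by (simp add: inner_commute)
      then have "(norm (x - m'))\<^sup>2 = (norm (x - m))\<^sup>2 + 2 * ((x - m) \<bullet> v) + (norm v)\<^sup>2"
        by (simp add: v_def)
      then show ?thesis
        using v assms(1) by (simp add: s_def Y_def field_simps power2_eq_square)
    qed
    moreover have "\<epsilon> < s * (y + s / 2) \<longleftrightarrow> \<epsilon> / s - s / 2 < y" for y
      using \<open>0 < s\<close> by (simp add: field_simps)
    ultimately show ?thesis by (auto simp: vimage_def)
  qed
  moreover have "measure ?G (Y -` A) = measure ?N A" if "A \<in> sets borel" for A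
  proof -
    have "Y \<in> measurable ?G lborel" "distr ?G lborel Y = ?N"
      using Y by (simp_all add: distributed_def)
    then show ?thesis
      using that measure_distr[of Y ?G lborel A]
      by (simp add: gaussian_vector_def)
  qed
  moreover have "N.prob {\<epsilon> / s - s / 2<..} \<le> N.prob {c - 1 / (2 * c)<..}"
    using \<open>c - 1 / (2 * c) \<le> \<epsilon> / s - s / 2\<close> by (intro N.finite_measure_mono) auto
  moreover have "N.prob {c - 1 / (2 * c)<..} \<le> \<delta>"
    unfolding c_def by (rule std_normal_tail_le_delta[OF assms(4,5)])
  ultimately show ?thesis by simp
qed (use assms in simp)

lemma gaussian_vector_indistinguishable:
  fixes m m' :: "real ^ 'v::finite"
  assumes "0 < \<sigma>" "0 < \<epsilon>" "\<epsilon> < 1" "0 < \<delta>" "\<delta> < 1"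
    and le: "norm (m - m') \<le> \<epsilon> * \<sigma> / sqrt (2 * ln (1.25 / \<delta>))"
    and S [measurable]: "S \<in> sets borel"
  shows "measure (gaussian_vector m \<sigma>) S \<le> exp \<epsilon> * measure (gaussian_vector m' \<sigma>) S + \<delta>"
proof -
  let ?G = "gaussian_vector m \<sigma>" and ?G' = "gaussian_vector m' \<sigma>"
  define L where "L x = ((norm (x - m'))\<^sup>2 - (norm (x - m))\<^sup>2) / (2 * \<sigma>\<^sup>2)" for x
  define B where "B = {x. \<epsilon> < L x}"
  have [measurable]: "L \<in> borel_measurable borel"
    unfolding L_def by measurable
  have [measurable]: "B \<in> sets borel"
    unfolding B_def by measurable
  interpret G: prob_space ?G by (rule prob_space_gaussian_vector[OF assms(1)])
  interpret G': prob_space ?G' by (rule prob_space_gaussian_vector[OF assms(1)])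
  have "emeasure ?G (S - B) = (\<integral>\<^sup>+x. ennreal (exp (L x)) * indicator (S - B) x \<partial>?G')"
    unfolding gaussian_vector_shift[OF assms(1), of m m'] L_def[symmetric]
    by (rule emeasure_density) (auto simp: measurable_cong_sets[OF sets_gaussian_vector refl])
  \<comment> \<open>Off \<open>B\<close> the loss is at most \<open>\<epsilon>\<close>, so the
    density is pointwise at most \<open>exp \<epsilon>\<close>. The part of \<open>S\<close> inside
    \<open>B\<close> is charged to the additive \<open>\<delta>\<close>.\<close>
  also have "\<dots> \<le> (\<integral>\<^sup>+x. ennreal (exp \<epsilon>) * indicator (S - B) x \<partial>?G')"
    by (intro nn_integral_mono) (auto simp: B_def split: split_indicator)
  also have "\<dots> = ennreal (exp \<epsilon>) * emeasure ?G' (S - B)"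
    by (rule nn_integral_cmult_indicator) simp
  finally have "G.prob (S - B) \<le> exp \<epsilon> * G'.prob (S - B)"
    by (simp add: G.emeasure_eq_measure G'.emeasure_eq_measure ennreal_mult[symmetric])
  also have "\<dots> \<le> exp \<epsilon> * G'.prob S"
    by (intro mult_left_mono G'.finite_measure_mono) auto
  finally have "G.prob (S - B) \<le> exp \<epsilon> * G'.prob S" .
  moreover have "G.prob B \<le> \<delta>"
    unfolding B_def L_def by (rule gaussian_vector_privacy_loss_tail[OF assms(1-6)])
  moreover have "G.prob S \<le> G.prob ((S - B) \<union> B)"
    by (rule G.finite_measure_mono) auto
  moreover have "G.prob ((S - B) \<union> B) \<le> G.prob (S - B) + G.prob B"
    by (rule measure_Un_le) auto
  ultimately show ?thesis by linarith
qed

theorem theorem1: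
  fixes D :: "('u, 'v::finite) database" and \<alpha> :: "real ^ 'v"
    and \<rho> \<sigma>\<^sub>p\<^sub>s \<epsilon> \<delta> :: real
  assumes "finite (dom D)"
    and "\<And>n i. n \<in> dom D \<Longrightarrow> 0 \<le> the (D n) $ i"
    and "\<And>i. 0 \<le> \<alpha> $ i"
    and "0 < \<rho>" "\<rho> < 1" "0 < \<sigma>\<^sub>p\<^sub>s"
    and "0 < \<epsilon>" "\<epsilon> < 1" "0 < \<delta>" "\<delta> < 1"
    and "\<And>n. n \<in> dom D \<Longrightarrow>
      norm (x_hat D - x_hat_minus D n) \<le> \<epsilon> * \<sigma>\<^sub>p\<^sub>s / (\<rho> * sqrt (2 * ln (1.25 / \<delta>)))"
  shows "differentially_private (gaussian_mechanism \<rho> \<sigma>\<^sub>p\<^sub>s (centered_log \<alpha>)) D \<epsilon> \<delta>"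
  unfolding differentially_private_def gaussian_mechanism_def
proof (intro ballI gaussian_vector_indistinguishable)
  fix n assume n: "n \<in> dom D"
  let ?\<mu> = "(1 - \<rho>) *\<^sub>R centered_log \<alpha>"
  \<comment> \<open>The public term is common to both means and cancels, so they differ by
    \<open>\<rho>\<close> times the difference of the private vectors. This \<open>\<rho>\<close>
    cancels the one in the denominator of the hypothesis.\<close>
  have "norm ((\<rho> *\<^sub>R x_hat D + ?\<mu>) - (\<rho> *\<^sub>R x_hat (remove_user n D) + ?\<mu>)) =
      norm (\<rho> *\<^sub>R (x_hat D - x_hat_minus D n))"
    by (simp add: x_hat_remove_user[OF assms(1) n] scaleR_diff_right)
  also have "\<dots> = \<rho> * norm (x_hat D - x_hat_minus D n)"
    using assms(4) by simp
  also have "\<dots> \<le> \<rho> * (\<epsilon> * \<sigma>\<^sub>p\<^sub>s / (\<rho> * sqrt (2 * ln (1.25 / \<delta>))))"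
    using assms(4) by (intro mult_left_mono assms(11)[OF n]) simp
  also have "\<dots> = \<epsilon> * \<sigma>\<^sub>p\<^sub>s / sqrt (2 * ln (1.25 / \<delta>))"
    using assms(4) by simp
  finally show "norm ((\<rho> *\<^sub>R x_hat D + ?\<mu>) - (\<rho> *\<^sub>R x_hat (remove_user n D) + ?\<mu>)) \<le>
      \<epsilon> * \<sigma>\<^sub>p\<^sub>s / sqrt (2 * ln (1.25 / \<delta>))" .
qed (use assms in simp_all)

end
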